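(* Let $X$ be a strongly zero-dimensional metrizable space, and let $Y$ and $Z$ be (arbitrary) topological spaces. Then $(X,Y,Z)$ is a Lebesgue triple.
   Context: A nonempty topological space $X$ is strongly zero-dimensional if it is completely regular and every finite functionally open cover of $X$ has a finite disjoint open refinement. (A set is functionally open if it is of the form $\{x: g(x)\neq 0\}$ for a continuous function $g:X\to\mathbb R$.) A mapping $f:X\times Y\to Z$ between topological spaces is separately continuous if for every $x\in X$ the mapping $y\mapsto f(x,y)$ is continuous on $Y$ and for every $y\in Y$ the mapping $x\mapsto f(x,y)$ is continuous on $X$. A mapping $f:S\to T$ between topological spaces belongs to the first Baire class if there is a sequence of continuous mappings $f_n:S\to T$ with $f_n(s)\to f(s)$ in $T$ for every $s\in S$. A collection $(X,Y,Z)$ of topological spaces is a Lebesgue triple if every separately continuous mapping $f:X\times Y\to Z$ belongs to the first Baire class (with $X\times Y$ carrying the product topology). *)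

theory Defs
  imports "HOL-Analysis.Analysis"
begin

definition functionally_openin :: "'a topology \<Rightarrow> 'a set \<Rightarrow> bool" where
  "functionally_openin X U \<longleftrightarrow>
     (\<exists>g. continuous_map X euclideanreal g \<and> U = {x \<in> topspace X. g x \<noteq> 0})"

(* completely_regular_space does not include any separation axiom on points; under the
   convention that it does, the Hausdorff part is automatic for metrizable X. *)
definition strongly_zero_dimensional :: "'a topology \<Rightarrow> bool" where
  "strongly_zero_dimensional X \<longleftrightarrow>
     topspace X \<noteq> {} \<and> completely_regular_space X \<and>
     (\<forall>\<U>. finite \<U> \<and> (\<forall>U\<in>\<U>. functionally_openin X U) \<and> \<Union>\<U> = topspace X \<longrightarrow>
        (\<exists>\<V>. finite \<V> \<and> pairwise disjnt \<V> \<and> (\<forall>V\<in>\<V>. openin X V) \<and> \<Union>\<V> = topspace X \<and>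
             (\<forall>V\<in>\<V>. \<exists>U\<in>\<U>. V \<subseteq> U)))"

definition separately_continuous_map ::
    "'a topology \<Rightarrow> 'b topology \<Rightarrow> 'c topology \<Rightarrow> ('a \<times> 'b \<Rightarrow> 'c) \<Rightarrow> bool" where
  "separately_continuous_map X Y Z f \<longleftrightarrow>
     (\<forall>x\<in>topspace X. continuous_map Y Z (\<lambda>y. f (x, y))) \<and>
     (\<forall>y\<in>topspace Y. continuous_map X Z (\<lambda>x. f (x, y)))"

definition first_Baire_class :: "'a topology \<Rightarrow> 'b topology \<Rightarrow> ('a \<Rightarrow> 'b) \<Rightarrow> bool" where
  "first_Baire_class S T f \<longleftrightarrow>
     (\<exists>F :: nat \<Rightarrow> 'a \<Rightarrow> 'b. (\<forall>n. continuous_map S T (F n)) \<and>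
        (\<forall>s\<in>topspace S. limitin T (\<lambda>n. F n s) (f s) sequentially))"

definition Lebesgue_triple :: "'a topology \<Rightarrow> 'b topology \<Rightarrow> 'c topology \<Rightarrow> bool" where
  "Lebesgue_triple X Y Z \<longleftrightarrow>
     (\<forall>f. separately_continuous_map X Y Z f \<longrightarrow> first_Baire_class (prod_topology X Y) Z f)"

end

theory Submission
  imports Defs
begin

text \<open>
  If \<open>X\<close> is covered by disjoint open sets of diameter at most \<open>1 / n\<close> and \<open>p\<^sub>n\<close> replaces every point by a
  chosen point near its piece, then \<open>f (p\<^sub>n x, y)\<close> is jointly continuous (locally it depends on \<open>y\<close>
  alone) and tends to \<open>f (x, y)\<close> by continuity in the first variable. The disjoint covers come from
  a well-ordering of \<open>X\<close> as in Rudin's proof of Stone's theorem: labelling \<open>z\<close> with the least point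
  within distance \<open>\<epsilon>\<close> of it gives uniformly separated classes once the points too close to the
  boundary of their ball are discarded, and strong zero-dimensionality thickens the
  union of these classes to a clopen set.
\<close>

text \<open>A Urysohn function yields two functionally open sets that cover \<open>X\<close>,
  \<open>P\<close> missing \<open>A\<close> and \<open>Q\<close> missing \<open>B\<close>. In a
  disjoint open refinement, the members inside \<open>Q\<close> and the remaining ones, which lie in
  \<open>P\<close>, have complementary open unions.\<close>

lemma strongly_zero_dimensional_clopen_separation:
  assumes X: "strongly_zero_dimensional X" and "normal_space X"
    and "closedin X A" "closedin X B" "disjnt A B"
  obtains C where "openin X C" "closedin X C" "A \<subseteq> C" "disjnt C B"
proof -
  obtain h where h: "continuous_map X (top_of_set {0..1::real}) h" "h ` A \<subseteq> {0}" "h ` B \<subseteq> {1}"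
    using Urysohn_lemma[OF assms(2-5), of 0 1] by auto
  then have cont: "continuous_map X euclideanreal h"
    using continuous_map_in_subtopology by blast
  define P Q where "P = {x \<in> topspace X. h x \<noteq> 0}" and "Q = {x \<in> topspace X. h x \<noteq> 1}"
  have "functionally_openin X P"
    unfolding functionally_openin_def P_def using cont by blast
  moreover have "functionally_openin X Q"
    unfolding functionally_openin_def Q_def
    by (rule exI[of _ "\<lambda>x. h x - 1"]) (auto intro!: continuous_intros cont)
  moreover have "\<Union>{P, Q} = topspace X"
    by (auto simp: P_def Q_def)
  ultimately have "finite {P, Q} \<and> (\<forall>U\<in>{P, Q}. functionally_openin X U) \<and> \<Union>{P, Q} = topspace X"
    by simp
  from X[unfolded strongly_zero_dimensional_def, THEN conjunct2, THEN conjunct2, rule_format, OF this]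
  obtain \<V> where "pairwise disjnt \<V>" "\<forall>V\<in>\<V>. openin X V" "\<Union>\<V> = topspace X"
      "\<forall>V\<in>\<V>. \<exists>U\<in>{P, Q}. V \<subseteq> U"
    by auto
  then have \<V>: "pairwise disjnt \<V>" "\<And>V. V \<in> \<V> \<Longrightarrow> openin X V"
      "\<Union>\<V> = topspace X" "\<And>V. V \<in> \<V> \<Longrightarrow> V \<subseteq> P \<or> V \<subseteq> Q"
    by auto
  define C where "C = \<Union>{V \<in> \<V>. V \<subseteq> Q}"
  have compl: "topspace X - C = \<Union>{V \<in> \<V>. \<not> V \<subseteq> Q}"
    using \<V>(1) unfolding \<V>(3)[symmetric] C_def pairwise_def disjnt_def by blast
  show thesis
  proof
    show "openin X C"
      unfolding C_def using \<V>(2) by auto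
    have "openin X (topspace X - C)"
      unfolding compl using \<V>(2) by auto
    then show "closedin X C"
      using \<open>openin X C\<close> by (simp add: closedin_def openin_subset)
    have "topspace X - C \<subseteq> P"
      unfolding compl using \<V>(4) by auto
    moreover have "A \<inter> P = {}"
      using h(2) by (auto simp: P_def)
    ultimately show "A \<subseteq> C"
      using closedin_subset[OF assms(3)] by blast
    show "disjnt C B"
      using h(3) by (auto simp: C_def Q_def disjnt_def)
  qed
qed

text \<open>Metric spaces are normal, and the closure of \<open>A\<close> is disjoint from the
  complement of the \<open>\<delta>\<close>-neighbourhood of \<open>A\<close>, so a clopen set
  separates the two.\<close>

lemma (in Metric_space) strongly_zero_dimensional_clopen_between:
  assumes "strongly_zero_dimensional mtopology" and "A \<subseteq> M" and "0 < \<delta>"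
  obtains C where "openin mtopology C" "closedin mtopology C" "A \<subseteq> C"
    "\<And>z. z \<in> C \<Longrightarrow> \<exists>a\<in>A. d z a < \<delta>"
proof -
  define N where "N = (\<Union>a\<in>A. mball a \<delta>)"
  have "openin mtopology N"
    unfolding N_def by auto
  then have "closedin mtopology (M - N)"
    by (metis closedin_diff closedin_topspace topspace_mtopology)
  moreover have "disjnt (mtopology closure_of A) (M - N)"
  proof -
    have "z \<in> N" if "z \<in> mtopology closure_of A" for z
      using that assms(3) unfolding metric_closure_of N_def by (force simp: commute)
    then show ?thesis
      by (auto simp: disjnt_def)
  qed
  ultimately obtain C where C: "openin mtopology C" "closedin mtopology C"
      "mtopology closure_of A \<subseteq> C" "disjnt C (M - N)"
    by (rule strongly_zero_dimensional_clopen_separation[OF assms(1)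
          metrizable_imp_normal_space[OF metrizable_space_mtopology] closedin_closure_of])
  show thesis
  proof
    show "A \<subseteq> C"
      using C(3) closure_of_subset[of A mtopology] assms(2) by simp
    show "\<exists>a\<in>A. d z a < \<delta>" if "z \<in> C" for z
    proof -
      have "z \<in> N"
        using that C openin_subset[OF C(1)] by (auto simp: disjnt_def)
      then show ?thesis
        by (auto simp: N_def commute)
    qed
  qed (use C in auto)
qed

text \<open>Points of \<open>A n\<close> that are close enough share their label, so the label of a
  nearby point of \<open>A n\<close> is locally constant on the clopen thickening
  \<open>C n\<close>. Cutting the sets \<open>C n\<close> down to disjoint open pieces lets these
  labels be glued to a single \<open>p\<close>.\<close>

lemma (in Metric_space) strongly_zero_dimensional_locally_constant_approx:
  assumes szd: "strongly_zero_dimensional mtopology" and "0 < \<epsilon>"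
  obtains p where "\<And>z. z \<in> M \<Longrightarrow> p z \<in> M" "\<And>z. z \<in> M \<Longrightarrow> d z (p z) < \<epsilon>"
    "\<And>z. z \<in> M \<Longrightarrow> \<exists>W. openin mtopology W \<and> z \<in> W \<and> (\<forall>w\<in>W. p w = p z)"
proof -
  \<comment> \<open>One half is spent on moving \<open>z\<close> to a point of some
    \<open>A n\<close>, the other on moving from there to its label.\<close>
  define e where "e = \<epsilon> / 2"
  have e: "0 < e"
    using assms(2) by (simp add: e_def)
  obtain r where r: "well_order_on M r"
    using well_order_on by blast
  then have wf: "wf (r - Id)"
    by (simp add: well_order_on_def)
  \<comment> \<open>The set to be minimised over is nonempty because it contains \<open>z\<close>
    itself.\<close>
  have "\<exists>x. x \<in> M \<and> d z x < e \<and> (\<forall>y. (y, x) \<in> r - Id \<longrightarrow> \<not> (y \<in> M \<and> d z y < e))" if "z \<in> M" for z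
    using wf_eq_minimal[THEN iffD1, OF wf, rule_format, of z "{x \<in> M. d z x < e}"] that e
    by auto
  then obtain lab where lab: "\<And>z. z \<in> M \<Longrightarrow> lab z \<in> M" "\<And>z. z \<in> M \<Longrightarrow> d z (lab z) < e"
      and lab_min: "\<And>z y. z \<in> M \<Longrightarrow> (y, lab z) \<in> r - Id \<Longrightarrow> y \<in> M \<Longrightarrow> \<not> d z y < e"
    by metis
  \<comment> \<open>The points that lie in the ball around their label with a margin of
    \<open>1 / Suc n\<close>. Every point has such a margin for some \<open>n\<close>, as
    \<open>d z (lab z) < e\<close> is strict.\<close>
  define A where "A n = {z \<in> M. d z (lab z) + 1 / Suc n \<le> e}" for n
  have separated_if_less: "1 / Suc n \<le> d z w"
    if "z \<in> A n" "w \<in> A n" "(lab z, lab w) \<in> r - Id" for n z w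
  proof -
    \<comment> \<open>As \<open>lab z\<close> strictly precedes \<open>lab w\<close>, minimality of
      \<open>lab w\<close> keeps \<open>w\<close> out of the ball around \<open>lab z\<close>, while
      \<open>z\<close> is inside it by the margin.\<close>
    have "e \<le> d w (lab z)"
      using that lab_min[of w "lab z"] lab(1)[of z] by (force simp: A_def)
    moreover have "d w (lab z) \<le> d z w + d z (lab z)"
      using that lab(1)[of z] triangle[of w z "lab z"] by (auto simp: A_def commute)
    ultimately show ?thesis
      using that by (simp add: A_def)
  qed
  have separated: "1 / Suc n \<le> d z w" if "z \<in> A n" "w \<in> A n" "lab z \<noteq> lab w" for n z w
  proof -
    have "(lab z, lab w) \<in> r \<or> (lab w, lab z) \<in> r"
      using r that lab(1) unfolding well_order_on_def linear_order_on_def total_on_def A_def by blast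
    then show ?thesis
      using separated_if_less[of z n w] separated_if_less[of w n z] that
      by (auto simp: commute)
  qed
  \<comment> \<open>The bound \<open>e\<close> controls the distance from \<open>z\<close> to
    \<open>p z\<close>. The factor 4 leaves room for a chain of three steps, each shorter than
    \<open>\<delta> n\<close>, to stay below the separation \<open>1 / Suc n\<close>.\<close>
  define \<delta> where "\<delta> n = min e (1 / (4 * real (Suc n)))" for n
  have \<delta>: "0 < \<delta> n" for n
    using e by (simp add: \<delta>_def)
  have "\<exists>C. openin mtopology C \<and> closedin mtopology C \<and> A n \<subseteq> C \<and> (\<forall>z\<in>C. \<exists>a\<in>A n. d z a < \<delta> n)" for n
    using strongly_zero_dimensional_clopen_between[OF szd _ \<delta>, of "A n" n]
    by (metis (no_types, lifting) A_def mem_Collect_eq subsetI)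
  then obtain C where C: "\<And>n. openin mtopology (C n)" "\<And>n. closedin mtopology (C n)"
      "\<And>n. A n \<subseteq> C n" "\<And>n z. z \<in> C n \<Longrightarrow> \<exists>a\<in>A n. d z a < \<delta> n"
    by metis
  \<comment> \<open>The chosen point need not depend continuously on \<open>z\<close>; only its
    label enters \<open>p\<close>.\<close>
  define near where "near n z = (SOME a. a \<in> A n \<and> d z a < \<delta> n)" for n z
  have near: "near n z \<in> A n" "d z (near n z) < \<delta> n" if "z \<in> C n" for n z
    using someI_ex[of "\<lambda>a. a \<in> A n \<and> d z a < \<delta> n"] C(4)[OF that] unfolding near_def by blast+
  have covered: "\<exists>n. z \<in> C n" if z: "z \<in> M" for z
  proof -
    obtain n where "inverse (real (Suc n)) < e - d z (lab z)"
      using reals_Archimedean[of "e - d z (lab z)"] lab(2)[OF z] by auto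
    then have "z \<in> A n"
      using z by (auto simp: A_def inverse_eq_divide)
    then show ?thesis
      using C(3) by blast
  qed
  define idx where "idx z = (LEAST n. z \<in> C n)" for z
  have idx: "z \<in> C (idx z)" if "z \<in> M" for z
    unfolding idx_def using covered[OF that] by (rule LeastI_ex)
  define p where "p z = lab (near (idx z) z)" for z
  show thesis
  proof
    fix z
    assume z: "z \<in> M"
    define n where "n = idx z"
    have zC: "z \<in> C n"
      using idx[OF z] by (simp add: n_def)
    define a where "a = near n z"
    have a: "a \<in> A n" "d z a < \<delta> n"
      using near[OF zC] by (auto simp: a_def)
    then have aM: "a \<in> M"
      by (simp add: A_def)
    have p: "p z = lab a"
      by (simp add: p_def a_def n_def)
    show "p z \<in> M"
      using p lab(1)[OF aM] by simp
    show "d z (p z) < \<epsilon>"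
      using triangle[OF z aM lab(1)[OF aM]] a(2) lab(2)[OF aM] p by (auto simp: \<delta>_def e_def)
    \<comment> \<open>Removing the earlier sets, which are closed, leaves an open set on which
      \<open>idx\<close> is constantly \<open>n\<close>; the ball makes the chosen points of
      \<open>z\<close> and \<open>w\<close> close enough to have equal labels.\<close>
    define W where "W = (C n - (\<Union>m<n. C m)) \<inter> mball z (\<delta> n)"
    have "p w = p z" if "w \<in> W" for w
    proof -
      have w: "w \<in> M" "w \<in> C n" "d z w < \<delta> n" "\<And>m. m < n \<Longrightarrow> w \<notin> C m"
        using that by (auto simp: W_def)
      then have "idx w = n"
        unfolding idx_def by (metis Least_equality linorder_not_less)
      define b where "b = near n w"
      have b: "b \<in> A n" "d w b < \<delta> n"
        using near[OF w(2)] by (auto simp: b_def)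
      then have bM: "b \<in> M"
        by (simp add: A_def)
      have "d a b \<le> d z a + d z w + d w b"
        using triangle[OF aM z bM] triangle[OF z w(1) bM] by (simp add: commute)
      also have "\<dots> < 3 * \<delta> n"
        using a(2) b(2) w(3) by simp
      also have "\<dots> \<le> 3 * (1 / (4 * real (Suc n)))"
        by (simp add: \<delta>_def)
      also have "\<dots> < 1 / Suc n"
        by (simp add: field_simps)
      finally have "lab a = lab b"
        using separated[OF a(1) b(1)] by fastforce
      then show ?thesis
        using p by (simp add: p_def b_def \<open>idx w = n\<close>)
    qed
    moreover have "openin mtopology W"
      unfolding W_def using C(1,2) by (intro openin_Int openin_diff closedin_Union) auto
    moreover have "z \<in> W"
      using zC z \<delta> not_less_Least unfolding W_def n_def idx_def by fastforce
    ultimately show "\<exists>W. openin mtopology W \<and> z \<in> W \<and> (\<forall>w\<in>W. p w = p z)"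
      by blast
  qed
qed

text \<open>On \<open>W \<times> topspace Y\<close>, with \<open>p\<close> constant on
  \<open>W\<close>, the map depends on \<open>y\<close> alone, so continuity in the second variable
  provides an open box around each point of a preimage.\<close>

lemma continuous_map_locally_constant_fst:
  assumes p: "\<And>x. x \<in> topspace X \<Longrightarrow> p x \<in> topspace X"
    and locally_const: "\<And>x. x \<in> topspace X \<Longrightarrow> \<exists>W. openin X W \<and> x \<in> W \<and> (\<forall>w\<in>W. p w = p x)"
    and f: "\<And>x. x \<in> topspace X \<Longrightarrow> continuous_map Y Z (\<lambda>y. f (x, y))"
  shows "continuous_map (prod_topology X Y) Z (\<lambda>(x, y). f (p x, y))"
  unfolding continuous_map_def
proof (intro conjI allI impI)
  show "(\<lambda>(x, y). f (p x, y)) \<in> topspace (prod_topology X Y) \<rightarrow> topspace Z"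
    using continuous_map_image_subset_topspace[OF f[OF p]] by fastforce
  fix U
  assume U: "openin Z U"
  let ?S = "{s \<in> topspace (prod_topology X Y). (case s of (x, y) \<Rightarrow> f (p x, y)) \<in> U}"
  show "openin (prod_topology X Y) ?S"
    unfolding openin_prod_topology_alt
  proof (intro allI impI)
    fix x y
    assume xy: "(x, y) \<in> ?S"
    then obtain W where W: "openin X W" "x \<in> W" "\<And>w. w \<in> W \<Longrightarrow> p w = p x"
      using locally_const[of x] by auto
    define V where "V = {y \<in> topspace Y. f (p x, y) \<in> U}"
    have "openin Y V"
      unfolding V_def using xy by (intro openin_continuous_map_preimage[OF f[OF p] U]) simp
    moreover have "y \<in> V"
      using xy by (simp add: V_def)
    moreover have "W \<times> V \<subseteq> ?S"
      using openin_subset[OF W(1)] by (auto simp: V_def dest: W(3))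
    ultimately show "\<exists>W V. openin X W \<and> openin Y V \<and> x \<in> W \<and> y \<in> V \<and> W \<times> V \<subseteq> ?S"
      using W by blast
  qed
qed

theorem theorem5p1:
  fixes X :: "'a topology" and Y :: "'b topology" and Z :: "'c topology"
  assumes "strongly_zero_dimensional X" and "metrizable_space X"
  shows "Lebesgue_triple X Y Z"
  unfolding Lebesgue_triple_def
proof (intro allI impI)
  fix f
  assume f: "separately_continuous_map X Y Z f"
  obtain M d where "Metric_space M d" and X: "X = Metric_space.mtopology M d"
    using assms(2) unfolding metrizable_space_def by blast
  interpret Metric_space M d
    by fact
  have "\<exists>p. (\<forall>z\<in>M. p z \<in> M \<and> d z (p z) < 1 / real (Suc n) \<and>
      (\<exists>W. openin mtopology W \<and> z \<in> W \<and> (\<forall>w\<in>W. p w = p z)))" for n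
    using strongly_zero_dimensional_locally_constant_approx[of "1 / real (Suc n)"] assms(1)
    unfolding X by (metis of_nat_0_less_iff zero_less_Suc zero_less_divide_1_iff)
  then obtain p where p: "\<And>n z. z \<in> M \<Longrightarrow> p n z \<in> M" "\<And>n z. z \<in> M \<Longrightarrow> d z (p n z) < 1 / real (Suc n)"
      "\<And>n z. z \<in> M \<Longrightarrow> \<exists>W. openin mtopology W \<and> z \<in> W \<and> (\<forall>w\<in>W. p n w = p n z)"
    by metis
  have p_lim: "limitin X (\<lambda>n. p n x) x sequentially" if x: "x \<in> M" for x
    unfolding X limit_metric_sequentially
  proof (intro conjI allI impI x)
    fix e :: real
    assume "0 < e"
    then obtain N where N: "inverse (real (Suc N)) < e"
      using reals_Archimedean by blast
    have "d (p n x) x < e" if "N \<le> n" for n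
    proof -
      have "1 / real (Suc n) \<le> 1 / real (Suc N)"
        using that by (simp add: frac_le)
      then show ?thesis
        using p(2)[OF x, of n] N by (simp add: commute inverse_eq_divide)
    qed
    then show "\<exists>N. \<forall>n\<ge>N. p n x \<in> M \<and> d (p n x) x < e"
      using p(1)[OF x] by blast
  qed
  show "first_Baire_class (prod_topology X Y) Z f"
    unfolding first_Baire_class_def
  proof (intro exI conjI allI ballI)
    show "continuous_map (prod_topology X Y) Z (\<lambda>(x, y). f (p n x, y))" for n
      using f p by (intro continuous_map_locally_constant_fst) (auto simp: X separately_continuous_map_def)
    show "limitin Z (\<lambda>n. (\<lambda>(x, y). f (p n x, y)) s) (f s) sequentially"
      if s_in: "s \<in> topspace (prod_topology X Y)" for s
    proof -
      obtain x y where s: "s = (x, y)" "x \<in> M" "y \<in> topspace Y"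
        using s_in by (auto simp: X)
      \<comment> \<open>Continuity in the first variable carries the convergence of
        \<open>p n x\<close> to \<open>x\<close> over to the values of \<open>f\<close> at fixed
        \<open>y\<close>.\<close>
      then have "continuous_map X Z (\<lambda>x. f (x, y))"
        using f by (simp add: separately_continuous_map_def)
      from continuous_map_limit[OF this p_lim[OF s(2)]] show ?thesis
        by (simp add: s o_def)
    qed
  qed
qed

end
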